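(* For every $n,k\in\mathbb N$ with $n\ge 2k$, $$ex_<(n,\text{Alt-}P_{2k})=2(k-1)n-(k-1)(2k-1).$$
   Context: An ordered graph on $n$ vertices has vertex set $[n]$ with its natural order. An ordered graph $G$ contains a copy of an ordered graph $H$ if there is an injective, order-preserving map $V(H)\to V(G)$ sending edges to edges; $ex_<(n,H)$ is the maximum number of edges of an ordered graph on $[n]$ containing no copy of $H$. The alternating path $\text{Alt-}P_t$ is the ordered path on vertex set $[t]$ whose vertex sequence is $t,1,t-1,2,t-2,3,\dots$ (e.g. for $t=6$ its edges are $16,15,25,24,34$); equivalently, it is an ordered path on $t$ vertices in which every pair of edges (including pairs sharing a vertex) is nested, where two edges are nested if the interval spanned by one contains the interval spanned by the other. *)

theory Defs
  imports Main
begin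

text \<open>An ordered graph is a pair \<open>(n, E)\<close> of its number of vertices and its edge set,
  the vertex set being \<open>{1..n}\<close> with the order of the natural numbers.\<close>

type_synonym ordered_graph = "nat \<times> nat set set"

definition vertices :: "ordered_graph \<Rightarrow> nat set" where
  "vertices G = {1..fst G}"

definition edges :: "ordered_graph \<Rightarrow> nat set set" where
  "edges G = snd G"

definition is_ordered_graph :: "ordered_graph \<Rightarrow> bool" where
  "is_ordered_graph G \<longleftrightarrow> edges G \<subseteq> {e. e \<subseteq> vertices G \<and> card e = 2}"

definition contains_copy :: "ordered_graph \<Rightarrow> ordered_graph \<Rightarrow> bool" where
  "contains_copy G H \<longleftrightarrow>
     (\<exists>f. f ` vertices H \<subseteq> vertices G \<and> inj_on f (vertices H) \<and> mono_on (vertices H) f \<and>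
          (\<forall>e\<in>edges H. f ` e \<in> edges G))"

text \<open>\<open>Max\<close> is unspecified on the empty set, but the set below is nonempty whenever
  \<open>H\<close> has an edge (take the graph without edges).\<close>

definition ex_ord :: "nat \<Rightarrow> ordered_graph \<Rightarrow> nat" where
  "ex_ord n H =
     Max {card (edges G) | G. is_ordered_graph G \<and> fst G = n \<and> \<not> contains_copy G H}"

text \<open>The vertex sequence \<open>t, 1, t - 1, 2, t - 2, 3, \<dots>\<close>, indexed from \<open>0\<close>; it is used for
  indices \<open>i < t\<close> only.\<close>

definition alt_vertex :: "nat \<Rightarrow> nat \<Rightarrow> nat" where
  "alt_vertex t i = (if even i then t - i div 2 else (i + 1) div 2)"

definition alt_path :: "nat \<Rightarrow> ordered_graph" where
  "alt_path t = (t, {{alt_vertex t i, alt_vertex t (i + 1)} | i. i + 1 < t})"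

lemma is_ordered_graph_alt_path: "is_ordered_graph (alt_path t)"
proof -
  have "{alt_vertex t i, alt_vertex t (i + 1)} \<subseteq> {1..t} \<and>
        card {alt_vertex t i, alt_vertex t (i + 1)} = 2" if "i + 1 < t" for i
  proof -
    have "alt_vertex t i \<noteq> alt_vertex t (i + 1)"
      using that by (auto simp: alt_vertex_def elim!: evenE oddE)
    moreover have "alt_vertex t i \<in> {1..t}" "alt_vertex t (i + 1) \<in> {1..t}"
      using that by (auto simp: alt_vertex_def elim!: evenE oddE)
    ultimately show ?thesis by simp
  qed
  then show ?thesis
    by (auto simp: is_ordered_graph_def alt_path_def vertices_def edges_def)
qed

lemma edges_alt_path_6: "edges (alt_path 6) = {{1,6}, {1,5}, {2,5}, {2,4}, {3,4}}"
proof -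
  have "{i. i + 1 < (6::nat)} = {0,1,2,3,4}" by auto
  then have "edges (alt_path 6) =
      (\<lambda>i. {alt_vertex 6 i, alt_vertex 6 (i + 1)}) ` {0,1,2,3,4}"
    unfolding alt_path_def edges_def by (auto simp: setcompr_eq_image)
  also have "\<dots> = {{1,6}, {1,5}, {2,5}, {2,4}, {3,4}}"
    by (simp add: alt_vertex_def insert_commute)
  finally show ?thesis .
qed

end

theory Submission
  imports Defs
begin

text \<open>
  Lower bound: keep exactly the pairs at distance at most \<open>2k - 2\<close>; the outermost edge of
  a copy of \<open>Alt-P\<^sub>2\<^sub>k\<close> has length at least \<open>2k - 1\<close>.

  Upper bound: delete from each vertex its longest edge to the right, and then, in what is left,
  from each vertex its longest edge to the left. If the vertices lie in an interval of \<open>d + 1\<close>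
  points, this deletes at most \<open>d + (d - 1)\<close> edges, and the remaining edges avoid both end points
  of the interval. By induction the remaining graph contains \<open>Alt-P\<^sub>2\<^sub>k\<close>; its outermost edge
  \<open>x\<^sub>1y\<^sub>1\<close> survived the second deletion, so an edge \<open>x\<^sub>0y\<^sub>1\<close> with \<open>x\<^sub>0 < x\<^sub>1\<close> survived the first
  one, and so there is an edge \<open>x\<^sub>0y\<^sub>0\<close> with \<open>y\<^sub>1 < y\<^sub>0\<close>. These two edges extend the path to
  \<open>Alt-P\<^sub>2\<^sub>k\<^sub>+\<^sub>2\<close>.
\<close>

section \<open>Upper bound, for sets of increasing pairs\<close>

text \<open>\<open>f\<close> lists the vertices of the path from left to right; the two families are
  the edges of \<open>alt_path (2*k)\<close> at even and at odd positions. Pairs replace two-element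
  sets so that left and right end points are projections.\<close>

definition pair_alt_path :: "(nat \<times> nat) set \<Rightarrow> nat \<Rightarrow> (nat \<Rightarrow> nat) \<Rightarrow> bool" where
  "pair_alt_path S k f \<longleftrightarrow> strict_mono_on {1..2*k} f \<and>
     (\<forall>i\<in>{1..k}. (f i, f (2*k + 1 - i)) \<in> S) \<and>
     (\<forall>i\<in>{1..<k}. (f i, f (2*k - i)) \<in> S)"

lemma pair_alt_path_mono: "pair_alt_path S k f \<Longrightarrow> S \<subseteq> T \<Longrightarrow> pair_alt_path T k f"
  unfolding pair_alt_path_def by blast

text \<open>The pairs \<open>(x, y)\<close> and \<open>(x, f (2*k))\<close> nest around the
  outermost edge \<open>(f 1, f (2*k))\<close>, so \<open>x\<close> and \<open>y\<close> become the
  new first and last vertices and all old indices shift by one.\<close>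

lemma pair_alt_path_extend:
  assumes f: "pair_alt_path S k f" and k: "k \<ge> 1"
    and x: "x < f 1" "(x, f (2*k)) \<in> S" and y: "f (2*k) < y" "(x, y) \<in> S"
  shows "\<exists>g. pair_alt_path S (Suc k) g"
proof
  define g where "g j = (if j \<le> 1 then x else if j \<le> 2*k + 1 then f (j - 1) else y)" for j
  have sm: "f i < f j" if "1 \<le> i" "i < j" "j \<le> 2*k" for i j
    using f that unfolding pair_alt_path_def strict_mono_on_def by auto
  have ge: "f 1 \<le> f i" and le: "f i \<le> f (2*k)" if "1 \<le> i" "i \<le> 2*k" for i
    using sm[of 1 i] sm[of i "2*k"] that by (cases "i = 1"; cases "i = 2*k"; force)+
  have "strict_mono_on {1..2 * Suc k} g"
  proof (rule strict_mono_onI)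
    fix i j assume ij: "i \<in> {1..2 * Suc k}" "j \<in> {1..2 * Suc k}" "i < j"
    consider "i = 1" "j \<le> 2*k + 1" | "i = 1" "j > 2*k + 1" | "i > 1" "j \<le> 2*k + 1"
      | "i > 1" "j > 2*k + 1"
      using ij by fastforce
    then show "g i < g j"
    proof cases
      case 1
      have "f 1 \<le> f (j - 1)" using 1 ij by (intro ge) auto
      with 1 ij x(1) show ?thesis by (simp add: g_def)
    next
      case 2
      then show ?thesis using x(1) y(1) ge[of "2*k"] k by (simp add: g_def)
    next
      case 3
      then show ?thesis using ij sm[of "i - 1" "j - 1"] by (simp add: g_def)
    next
      case 4
      have "f (i - 1) \<le> f (2*k)" using 4 ij by (intro le) auto
      with 4 ij y(1) show ?thesis by (simp add: g_def)
    qed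
  qed
  moreover have "(g i, g (2 * Suc k + 1 - i)) \<in> S" if "i \<in> {1..Suc k}" for i
  proof (cases "i = 1")
    case True
    then show ?thesis using y k by (simp add: g_def)
  next
    case False
    with that have "i - 1 \<in> {1..k}" "2 * Suc k + 1 - i - 1 = 2*k + 1 - (i - 1)"
      by auto
    with f have "(f (i - 1), f (2 * Suc k + 1 - i - 1)) \<in> S"
      unfolding pair_alt_path_def by metis
    then show ?thesis using False that by (auto simp: g_def)
  qed
  moreover have "(g i, g (2 * Suc k - i)) \<in> S" if "i \<in> {1..<Suc k}" for i
  proof (cases "i = 1")
    case True
    then show ?thesis using x k by (simp add: g_def)
  next
    case False
    with that have "i - 1 \<in> {1..<k}" "2 * Suc k - i - 1 = 2*k - (i - 1)"
      by auto
    with f have "(f (i - 1), f (2 * Suc k - i - 1)) \<in> S"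
      unfolding pair_alt_path_def by metis
    then show ?thesis using False that by (auto simp: g_def)
  qed
  ultimately show "pair_alt_path S (Suc k) g"
    unfolding pair_alt_path_def by blast
qed

text \<open>The interval \<open>{l..r}\<close> is kept general because the induction shrinks it at
  both ends. With \<open>d = r - l\<close>, passing from \<open>Suc k\<close> on
  \<open>{l..r}\<close> to \<open>k\<close> on the inner interval lowers the threshold by exactly
  \<open>2 * d - 1\<close>, the most that the two deletions can remove.\<close>

lemma pair_alt_path_exists:
  fixes S :: "(nat \<times> nat) set"
  assumes "S \<subseteq> {(a, b). l \<le> a \<and> a < b \<and> b \<le> r}"
    and "l + 2*k < r"
    and "int (card S) > 2 * int k * (int r - int l + 1) - int k * (2 * int k + 1)"
  shows "\<exists>f. pair_alt_path S (Suc k) f"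
  using assms
proof (induction k arbitrary: S l r)
  case 0
  then obtain a b where ab: "(a, b) \<in> S" by (cases "S = {}") auto
  with 0 have "a < b" by auto
  with ab have "pair_alt_path S (Suc 0) (\<lambda>i. if i \<le> 1 then a else b)"
    by (auto simp: pair_alt_path_def strict_mono_on_def)
  then show ?case by blast
next
  case (Suc k)
  define S1 where "S1 = {(a, b) \<in> S. \<exists>b'>b. (a, b') \<in> S}"
  define S2 where "S2 = {(a, b) \<in> S1. \<exists>a'<a. (a', b) \<in> S1}"
  have "S \<subseteq> {..r} \<times> {..r}" using Suc.prems(1) by auto
  then have fin: "finite S" by (rule finite_subset) auto
  have sub: "S1 \<subseteq> S" "S2 \<subseteq> S1" by (auto simp: S1_def S2_def)
  have S1: "S1 \<subseteq> {(a, b). l \<le> a \<and> a < b \<and> b < r}"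
    using Suc.prems(1) unfolding S1_def by fastforce
  have S2: "S2 \<subseteq> {(a, b). Suc l \<le> a \<and> a < b \<and> b \<le> r - 1}"
    using S1 unfolding S2_def by fastforce
  have "card (S - S1) \<le> card {l..<r}"
  proof (rule card_inj_on_le)
    \<comment> \<open>Of two pairs of \<open>S\<close> with the same left end point, the longer one
      puts the shorter one into \<open>S1\<close>.\<close>
    show "inj_on fst (S - S1)"
      by (auto simp: inj_on_def S1_def) (metis nat_neq_iff)
  qed (use Suc.prems(1) in fastforce)+
  \<comment> \<open>Pairs of \<open>S1\<close> end before \<open>r\<close>, which leaves one right
    end point fewer than there were left end points.\<close>
  moreover have "card (S1 - S2) \<le> card {Suc l..<r}"
  proof (rule card_inj_on_le)
    show "inj_on snd (S1 - S2)"
      by (auto simp: inj_on_def S2_def) (metis nat_neq_iff)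
  qed (use S1 in fastforce)+
  moreover have "card S = card (S - S1) + card S1" "card S1 = card (S1 - S2) + card S2"
    using sub fin by (metis card_Diff_subset card_mono finite_subset le_add_diff_inverse2)+
  ultimately have "int (card S) \<le> int (card S2) + 2 * (int r - int l) - 1"
    using Suc.prems(2) by (simp add: of_nat_diff)
  with Suc.prems(2,3)
  have "int (card S2) > 2 * int k * (int (r - 1) - int (Suc l) + 1) - int k * (2 * int k + 1)"
    by (simp add: of_nat_diff algebra_simps)
  moreover have "Suc l + 2*k < r - 1" using Suc.prems(2) by simp
  ultimately obtain f where f: "pair_alt_path S2 (Suc k) f"
    using Suc.IH[OF S2] by blast
  \<comment> \<open>Index 1 of the first family is the outermost edge.\<close>
  then have "(f 1, f (2 * Suc k + 1 - 1)) \<in> S2"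
    unfolding pair_alt_path_def by (metis atLeastAtMost_iff le_add1 le_refl plus_1_eq_Suc)
  then obtain x where x: "x < f 1" "(x, f (2 * Suc k)) \<in> S1" by (auto simp: S2_def)
  then obtain y where y: "f (2 * Suc k) < y" "(x, y) \<in> S" by (auto simp: S1_def)
  have "pair_alt_path S (Suc k) f" using f sub by (blast intro: pair_alt_path_mono)
  from pair_alt_path_extend[OF this _ x(1) _ y] x(2) sub(1) show ?case by auto
qed

section \<open>Transfer to ordered graphs\<close>

lemma contains_copy_alt_pathI:
  assumes G: "is_ordered_graph G"
    and f: "pair_alt_path {(a, b). a < b \<and> {a, b} \<in> edges G} k f"
  shows "contains_copy G (alt_path (2*k))"
  unfolding contains_copy_def
proof (intro exI conjI ballI)
  have sm: "strict_mono_on {1..2*k} f"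
    and e1: "\<And>i. i \<in> {1..k} \<Longrightarrow> {f i, f (2*k + 1 - i)} \<in> edges G"
    and e2: "\<And>i. i \<in> {1..<k} \<Longrightarrow> {f i, f (2*k - i)} \<in> edges G"
    using f unfolding pair_alt_path_def by auto
  have V: "vertices (alt_path (2*k)) = {1..2*k}" by (simp add: vertices_def alt_path_def)
  show "inj_on f (vertices (alt_path (2*k)))" "mono_on (vertices (alt_path (2*k))) f"
    unfolding V using sm by (rule strict_mono_on_imp_inj_on, rule strict_mono_on_imp_mono_on)
  show "f ` vertices (alt_path (2*k)) \<subseteq> vertices G"
  proof (rule image_subsetI)
    fix i assume "i \<in> vertices (alt_path (2*k))"
    then have i: "1 \<le> i" "i \<le> 2*k" unfolding V by auto
    \<comment> \<open>The first family is a perfect matching of the indices \<open>{1..2*k}\<close>,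
      so every \<open>f i\<close> is an end of an edge.\<close>
    have "\<exists>e\<in>edges G. f i \<in> e"
    proof (cases "i \<le> k")
      case True
      then show ?thesis using e1[of i] i by auto
    next
      case False
      with i have "2*k + 1 - i \<in> {1..k}" "2*k + 1 - (2*k + 1 - i) = i" by auto
      then show ?thesis using e1[of "2*k + 1 - i"] by auto
    qed
    then show "f i \<in> vertices G" using G by (auto simp: is_ordered_graph_def)
  qed
  fix e assume "e \<in> edges (alt_path (2*k))"
  then obtain i where i: "i + 1 < 2*k" and
    e: "e = {alt_vertex (2*k) i, alt_vertex (2*k) (i + 1)}"
    by (auto simp: alt_path_def edges_def)
  show "f ` e \<in> edges G"
  proof (cases "even i")
    case True
    then obtain j where "i = 2*j" by blast
    then have "e = {2*k + 1 - (j + 1), j + 1}" "j + 1 \<in> {1..k}"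
      using i e by (auto simp: alt_vertex_def)
    then show ?thesis using e1[of "j + 1"] by (simp add: insert_commute)
  next
    case False
    then obtain j where "i = 2*j + 1" by (blast elim: oddE)
    then have "e = {j + 1, 2*k - (j + 1)}" "j + 1 \<in> {1..<k}"
      using i e by (auto simp: alt_vertex_def)
    then show ?thesis using e2[of "j + 1"] by simp
  qed
qed

lemma bij_betw_ordered_pairs:
  fixes E :: "'a::linorder set set"
  assumes "\<And>e. e \<in> E \<Longrightarrow> card e = 2"
  shows "bij_betw (\<lambda>(a, b). {a, b}) {(a, b). a < b \<and> {a, b} \<in> E} E"
  unfolding bij_betw_def
proof
  show "inj_on (\<lambda>(a, b). {a, b}) {(a, b). a < b \<and> {a, b} \<in> E}"
    by (auto simp: inj_on_def doubleton_eq_iff)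
  have "e \<in> (\<lambda>(a, b). {a, b}) ` {(a, b). a < b \<and> {a, b} \<in> E}" if e: "e \<in> E" for e
  proof -
    obtain a b where "e = {a, b}" "a \<noteq> b" using assms[OF e] by (auto simp: card_2_iff)
    then have "e = {min a b, max a b}" "min a b < max a b" by (auto simp: min_def max_def)
    with e show ?thesis by (auto intro!: image_eqI[of _ _ "(min a b, max a b)"])
  qed
  then show "(\<lambda>(a, b). {a, b}) ` {(a, b). a < b \<and> {a, b} \<in> E} = E" by auto
qed

text \<open>A larger edge set would satisfy the threshold of \<open>pair_alt_path_exists\<close> on
  \<open>{1..fst G}\<close>.\<close>

lemma card_edges_alt_path_free:
  assumes G: "is_ordered_graph G" and free: "\<not> contains_copy G (alt_path (2 * Suc k))"
    and n: "2 * Suc k \<le> fst G"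
  shows "int (card (edges G)) \<le> 2 * int k * int (fst G) - int k * (2 * int k + 1)"
proof (rule ccontr)
  let ?S = "{(a, b). a < b \<and> {a, b} \<in> edges G}"
  assume "\<not> ?thesis"
  moreover have "card ?S = card (edges G)"
    using G by (intro bij_betw_same_card[OF bij_betw_ordered_pairs])
      (auto simp: is_ordered_graph_def)
  ultimately have "int (card ?S) > 2 * int k * (int (fst G) - int 1 + 1) - int k * (2 * int k + 1)"
    by simp
  moreover have "?S \<subseteq> {(a, b). 1 \<le> a \<and> a < b \<and> b \<le> fst G}"
    using G by (auto simp: is_ordered_graph_def vertices_def)
  ultimately obtain f where "pair_alt_path ?S (Suc k) f"
    using pair_alt_path_exists[of ?S 1 "fst G" k] n by auto
  with contains_copy_alt_pathI[OF G] free show False by blast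
qed

section \<open>Lower bound, by the graph of short edges\<close>

definition short_edges :: "nat \<Rightarrow> nat \<Rightarrow> nat set set" where
  "short_edges n m = {{a, a + d} | a d. 1 \<le> d \<and> d \<le> m \<and> 1 \<le> a \<and> a + d \<le> n}"

text \<open>There are \<open>n - d\<close> pairs at distance \<open>d\<close>; doubling avoids a
  division in the sum over \<open>d\<close>.\<close>

lemma card_short_edges:
  assumes "m \<le> n"
  shows "2 * int (card (short_edges n m)) = 2 * int m * int n - int m * (int m + 1)"
proof -
  have "short_edges n m = (\<lambda>(d, a). {a, a + d}) ` (SIGMA d:{1..m}. {1..n - d})"
  proof (intro equalityI subsetI)
    fix e assume "e \<in> short_edges n m"
    then obtain a d where "e = {a, a + d}" "1 \<le> d" "d \<le> m" "1 \<le> a" "a + d \<le> n"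
      by (auto simp: short_edges_def)
    then show "e \<in> (\<lambda>(d, a). {a, a + d}) ` (SIGMA d:{1..m}. {1..n - d})"
      by (intro image_eqI[of _ _ "(d, a)"]) auto
  next
    fix e assume "e \<in> (\<lambda>(d, a). {a, a + d}) ` (SIGMA d:{1..m}. {1..n - d})"
    then obtain a d where "e = {a, a + d}" "1 \<le> d" "d \<le> m" "1 \<le> a" "a \<le> n - d" by auto
    moreover from this assms have "a + d \<le> n" by linarith
    ultimately show "e \<in> short_edges n m" unfolding short_edges_def by blast
  qed
  moreover have "inj_on (\<lambda>(d, a). {a, a + d}) (SIGMA d:{1..m}. {1..n - d})"
    by (auto simp: inj_on_def doubleton_eq_iff)
  ultimately have "card (short_edges n m) = (\<Sum>d=1..m. n - d)"
    by (simp add: card_image)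
  moreover have "2 * int (\<Sum>d=1..m. n - d) = 2 * int m * int n - int m * (int m + 1)"
    using assms by (induction m) (auto simp: algebra_simps)
  ultimately show ?thesis by simp
qed

lemma is_ordered_graph_short_edges: "is_ordered_graph (n, short_edges n m)"
  by (auto simp: is_ordered_graph_def short_edges_def edges_def vertices_def)

lemma strict_mono_on_nat_gap:
  fixes f :: "nat \<Rightarrow> nat"
  assumes "strict_mono_on {a..b} f" "a \<le> b"
  shows "f a + (b - a) \<le> f b"
  using assms(2,1)
proof (induction b rule: dec_induct)
  case (step b)
  then have "f a + (b - a) \<le> f b" "f b < f (Suc b)"
    by (auto simp: strict_mono_on_def)
  with step show ?case by auto
qed simp

lemma short_edges_alt_path_free:
  assumes k: "k \<ge> 1"
  shows "\<not> contains_copy (n, short_edges n (2*k - 2)) (alt_path (2*k))"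
proof
  assume "contains_copy (n, short_edges n (2*k - 2)) (alt_path (2*k))"
  then obtain f where inj: "inj_on f {1..2*k}" and mono: "mono_on {1..2*k} f"
    and e: "\<And>e. e \<in> edges (alt_path (2*k)) \<Longrightarrow> f ` e \<in> short_edges n (2*k - 2)"
    by (auto simp: contains_copy_def vertices_def alt_path_def edges_def)
  \<comment> \<open>A copy is only weakly monotone by definition; injectivity makes it
    strict.\<close>
  have "strict_mono_on {1..2*k} f"
  proof (rule strict_mono_onI)
    fix i j assume ij: "i \<in> {1..2*k}" "j \<in> {1..2*k}" "i < j"
    then have "f i \<le> f j" using mono_onD[OF mono] by simp
    moreover have "f i \<noteq> f j" using inj_onD[OF inj] ij by blast
    ultimately show "f i < f j" by simp
  qed
  from strict_mono_on_nat_gap[OF this] k have gap: "f 1 + (2*k - 1) \<le> f (2*k)" by simp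
  \<comment> \<open>This is the edge at position 0, the outermost one, whose image has length at
    least \<open>2*k - 1\<close>.\<close>
  have "{2*k, 1} \<in> edges (alt_path (2*k))"
    unfolding alt_path_def edges_def
    using k by (auto simp: alt_vertex_def intro!: exI[of _ 0])
  from e[OF this] obtain a d where "{f (2*k), f 1} = {a, a + d}" "d \<le> 2*k - 2"
    by (auto simp: short_edges_def)
  with gap k show False by (auto simp: doubleton_eq_iff)
qed

section \<open>The extremal number\<close>

theorem theorem2p7:
  fixes n k :: nat
  assumes "k \<ge> 1" and "n \<ge> 2 * k"
  shows "int (ex_ord n (alt_path (2 * k)))
           = 2 * (int k - 1) * int n - (int k - 1) * (2 * int k - 1)"
proof -
  obtain j where j: "k = Suc j" using assms(1) by (cases k) auto
  let ?m = "2*k - 2"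
  let ?A = "{card (edges G) | G. is_ordered_graph G \<and> fst G = n \<and>
                \<not> contains_copy G (alt_path (2*k))}"
  have c: "int (card (short_edges n ?m)) = 2 * int j * int n - int j * (2 * int j + 1)"
    using card_short_edges[of ?m n] assms(2) j by (simp add: algebra_simps)
  have "Max ?A = card (short_edges n ?m)"
  proof (rule Max_eqI)
    have le: "x \<le> card (short_edges n ?m)" if "x \<in> ?A" for x
      using that card_edges_alt_path_free[of _ j] assms(2) c
      by (auto simp: j simp flip: of_nat_le_iff[where 'a = int])
    then show "x \<le> card (short_edges n ?m)" if "x \<in> ?A" for x
      using that .
    \<comment> \<open>Finiteness comes from the upper bound itself, as \<open>?A\<close> is a
      bounded set of naturals.\<close>
    from le show "finite ?A" by (meson finite_nat_set_iff_bounded_le)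
    have "card (short_edges n ?m) = card (edges (n, short_edges n ?m))"
      by (simp add: edges_def)
    then show "card (short_edges n ?m) \<in> ?A"
      using is_ordered_graph_short_edges short_edges_alt_path_free[OF assms(1)]
      by (intro CollectI exI[of _ "(n, short_edges n ?m)"]) auto
  qed
  with c show ?thesis by (simp add: ex_ord_def j algebra_simps)
qed

end
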